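(* The following two first-order expansions hold. (i) (Column/right whitening.) Let $\mathbf M\in\mathbb R^{p\times q}$ have full column rank, and set $\mathbf D_c:=\operatorname{diag}(\|\mathbf M_{:,1}\|_2,\dots,\|\mathbf M_{:,q}\|_2)\succ0$, $\mathbf N_c:=\mathbf M\mathbf D_c^{-1}$, $\mathbf C_c:=\mathbf N_c^\top\mathbf N_c-\mathbf I_q$. If $\|\mathbf D_c\mathbf C_c\mathbf D_c\|_2$ is sufficiently small, then $$\operatorname{Orth}_r(\mathbf M):=\mathbf M(\mathbf M^\top\mathbf M)^{-1/2}=\mathbf N_c-\mathbf N_c\mathbf L_c\mathbf D_c^{-1}+\mathcal O\bigl(\|\mathbf D_c\mathbf C_c\mathbf D_c\|_2^2\bigr),$$ where $\mathbf L_c$ is the unique solution of $\mathbf D_c\mathbf L_c+\mathbf L_c\mathbf D_c=\mathbf D_c\mathbf C_c\mathbf D_c$. In particular, $\operatorname{Orth}_r(\mathbf M)=\mathbf N_c+\mathcal O(\|\mathbf C_c\|_2)$. (ii) (Row/left whitening.) Let $\mathbf M\in\mathbb R^{p\times q}$ have full row rank, and set $\mathbf D_r:=\operatorname{diag}(\|\mathbf M_{1,:}\|_2,\dots,\|\mathbf M_{p,:}\|_2)\succ0$, $\mathbf N_r:=\mathbf D_r^{-1}\mathbf M$, $\mathbf C_r:=\mathbf N_r\mathbf N_r^\top-\mathbf I_p$. If $\|\mathbf D_r\mathbf C_r\mathbf D_r\|_2$ is sufficiently small, then $$\operatorname{Orth}_\ell(\mathbf M):=(\mathbf M\mathbf M^\top)^{-1/2}\mathbf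 M=\mathbf N_r-\mathbf D_r^{-1}\mathbf L_r\mathbf N_r+\mathcal O\bigl(\|\mathbf D_r\mathbf C_r\mathbf D_r\|_2^2\bigr),$$ where $\mathbf L_r$ is the unique solution of $\mathbf D_r\mathbf L_r+\mathbf L_r\mathbf D_r=\mathbf D_r\mathbf C_r\mathbf D_r$. In particular, $\operatorname{Orth}_\ell(\mathbf M)=\mathbf N_r+\mathcal O(\|\mathbf C_r\|_2)$.
   Context: $\mathbf M_{:,j}$ and $\mathbf M_{i,:}$ denote the $j$-th column and $i$-th row of $\mathbf M$; $\|\cdot\|_2$ is the Euclidean norm of vectors and the operator norm of matrices; $\mathbf A^{-1/2}$ is the inverse of the positive definite square root of a positive definite $\mathbf A$. Convention for asymptotics: $\mathcal O(x)$ stands for a matrix remainder $\mathbf E$ with $\|\mathbf E\|_2\le Kx$. The constant $K$ and the threshold in "sufficiently small" may depend on the dimensions and on the fixed diagonal matrix $\mathbf D_c$ (respectively $\mathbf D_r$), but not on the perturbation: i.e. for each fixed positive diagonal matrix $\mathbf D$ there are $\delta,K>0$ such that the expansion holds for all $\mathbf M$ with $\mathbf D_c=\mathbf D$ (respectively $\mathbf D_r=\mathbf D$) satisfying the rank hypothesis and $\|\mathbf D_c\mathbf C_c\mathbf D_c\|_2\le\delta$ (respectively $\|\mathbf D_r\mathbf C_r\mathbf D_r\|_2\le\delta$). *)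

theory Defs
  imports "HOL-Analysis.Analysis"
begin

text \<open>A matrix in \<open>\<real>\<^sup>p\<^sup>\<times>\<^sup>q\<close> has type \<open>real ^ 'q ^ 'p\<close>.
  The library norm of such a matrix is the Frobenius norm, so the operator norm is
  introduced separately.\<close>

abbreviation opnorm :: "real ^ 'q ^ 'p \<Rightarrow> real"
  where "opnorm A \<equiv> onorm (\<lambda>x. A *v x)"

definition positive_definite :: "real ^ 'n ^ 'n \<Rightarrow> bool"
  where "positive_definite A \<longleftrightarrow> transpose A = A \<and> (\<forall>x. x \<noteq> 0 \<longrightarrow> 0 < x \<bullet> (A *v x))"

text \<open>The descriptions below are meaningful only if \<open>A\<close> is positive definite.\<close>

definition pd_sqrt :: "real ^ 'n ^ 'n \<Rightarrow> real ^ 'n ^ 'n"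
  where "pd_sqrt A = (THE S. positive_definite S \<and> S ** S = A)"

definition inv_sqrt :: "real ^ 'n ^ 'n \<Rightarrow> real ^ 'n ^ 'n"
  where "inv_sqrt A = matrix_inv (pd_sqrt A)"

definition diag_mat :: "real ^ 'n \<Rightarrow> real ^ 'n ^ 'n"
  where "diag_mat d = (\<chi> i j. if i = j then d $ i else 0)"

definition sylvester_eq :: "real ^ 'n ^ 'n \<Rightarrow> real ^ 'n ^ 'n \<Rightarrow> real ^ 'n ^ 'n \<Rightarrow> bool"
  where "sylvester_eq D C L \<longleftrightarrow> D ** L + L ** D = D ** C ** D"

definition D_c :: "real ^ 'q ^ 'p \<Rightarrow> real ^ 'q ^ 'q"
  where "D_c M = diag_mat (\<chi> j. norm (column j M))"

definition N_c :: "real ^ 'q ^ 'p \<Rightarrow> real ^ 'q ^ 'p"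
  where "N_c M = M ** matrix_inv (D_c M)"

definition C_c :: "real ^ 'q ^ 'p \<Rightarrow> real ^ 'q ^ 'q"
  where "C_c M = transpose (N_c M) ** N_c M - mat 1"

definition L_c :: "real ^ 'q ^ 'p \<Rightarrow> real ^ 'q ^ 'q"
  where "L_c M = (THE L. sylvester_eq (D_c M) (C_c M) L)"

definition Orth_r :: "real ^ 'q ^ 'p \<Rightarrow> real ^ 'q ^ 'p"
  where "Orth_r M = M ** inv_sqrt (transpose M ** M)"

definition D_r :: "real ^ 'q ^ 'p \<Rightarrow> real ^ 'p ^ 'p"
  where "D_r M = diag_mat (\<chi> i. norm (row i M))"

definition N_r :: "real ^ 'q ^ 'p \<Rightarrow> real ^ 'q ^ 'p"
  where "N_r M = matrix_inv (D_r M) ** M"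

definition C_r :: "real ^ 'q ^ 'p \<Rightarrow> real ^ 'p ^ 'p"
  where "C_r M = N_r M ** transpose (N_r M) - mat 1"

definition L_r :: "real ^ 'q ^ 'p \<Rightarrow> real ^ 'p ^ 'p"
  where "L_r M = (THE L. sylvester_eq (D_r M) (C_r M) L)"

definition Orth_l :: "real ^ 'q ^ 'p \<Rightarrow> real ^ 'q ^ 'p"
  where "Orth_l M = inv_sqrt (M ** transpose M) ** M"

end

theory Submission
  imports Defs
begin

text \<open>
  Writing \<open>M = N D\<close> and \<open>E = D C D\<close>, the Gram matrix is \<open>M\<^sup>T M = D\<^sup>2 + E\<close>. A matrix \<open>D + X\<close> squares
  to it iff \<open>D X + X D = E - X\<^sup>2\<close>, i.e. iff \<open>X\<close> is a fixed point of \<open>X \<mapsto> \<Lambda> (E - X\<^sup>2)\<close>, where \<open>\<Lambda>\<close> inverts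
  the Sylvester operator of \<open>D\<close>. For small \<open>E\<close> this map is a contraction of a small ball, so the
  square root is \<open>D + X\<close> with \<open>X = O(E)\<close> and \<open>X - L = - \<Lambda> (X\<^sup>2) = O(E\<^sup>2)\<close>. The expansion of
  \<open>N D (D + X)\<^sup>-\<^sup>1\<close> is then algebra. All estimates use the Frobenius norm, which is submultiplicative,
  equivalent to the operator norm, and invariant under transposition; the row version is the column
  version for the transpose.
\<close>

section \<open>The Frobenius norm\<close>

text \<open>A row of the product is a combination of the rows of \<open>B\<close> with coefficients
  from a row of \<open>A\<close>, so Cauchy-Schwarz bounds it. The row bounds are then combined in
  the Euclidean norm.\<close>

lemma norm_matrix_mult_le:
  fixes A :: "real ^ 'n ^ 'm" and B :: "real ^ 'k ^ 'n"
  shows "norm (A ** B) \<le> norm A * norm B"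
proof -
  have row: "norm ((A ** B) $ i) \<le> norm (A $ i) * norm B" for i
  proof -
    have "(A ** B) $ i = (\<Sum>k\<in>UNIV. A $ i $ k *\<^sub>R B $ k)"
      by (simp add: vec_eq_iff matrix_matrix_mult_def)
    then have "norm ((A ** B) $ i) \<le> (\<Sum>k\<in>UNIV. norm (A $ i $ k *\<^sub>R B $ k))"
      by (metis norm_sum)
    also have "\<dots> = (\<Sum>k\<in>UNIV. \<bar>A $ i $ k\<bar> * \<bar>norm (B $ k)\<bar>)"
      by simp
    also have "\<dots> \<le> L2_set (\<lambda>k. A $ i $ k) UNIV * L2_set (\<lambda>k. norm (B $ k)) UNIV"
      by (rule L2_set_mult_ineq)
    also have "\<dots> = norm (A $ i) * norm B"
      by (simp add: norm_vec_def L2_set_def)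
    finally show ?thesis .
  qed
  have "norm (A ** B) \<le> L2_set (\<lambda>i. norm (A $ i) * norm B) UNIV"
    unfolding norm_vec_def[of "A ** B"] by (rule L2_set_mono) (auto intro: row)
  also have "\<dots> = norm A * norm B"
    by (simp add: norm_vec_def[of A] L2_set_left_distrib)
  finally show ?thesis .
qed

lemma norm_matrix_vector_mult_le:
  fixes A :: "real ^ 'n ^ 'm"
  shows "norm (A *v x) \<le> norm A * norm x"
proof -
  have comp: "\<bar>(A *v x) $ i\<bar> \<le> norm (A $ i) * norm x" for i
    by (simp add: matrix_vector_mul_component Cauchy_Schwarz_ineq2)
  have "norm (A *v x) \<le> L2_set (\<lambda>i. norm (A $ i) * norm x) UNIV"
    unfolding norm_vec_def[of "A *v x"] by (rule L2_set_mono) (auto intro: comp)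
  also have "\<dots> = norm A * norm x"
    by (simp add: norm_vec_def[of A] L2_set_left_distrib)
  finally show ?thesis .
qed

lemma opnorm_le_norm:
  fixes A :: "real ^ 'n ^ 'm"
  shows "opnorm A \<le> norm A"
  by (rule onorm_le) (rule norm_matrix_vector_mult_le)

lemma opnorm_nonneg:
  fixes A :: "real ^ 'n ^ 'm"
  shows "0 \<le> opnorm A"
  by (rule onorm_pos_le) (rule matrix_vector_mul_bounded_linear)

text \<open>Every entry is at most the operator norm. The crude dimension factor is harmless, since
  the constants of the expansion may depend on the dimensions.\<close>

lemma norm_le_opnorm:
  fixes A :: "real ^ 'n ^ 'm"
  shows "norm A \<le> real (CARD('m) * CARD('n)) * opnorm A"
proof -
  have "norm A \<le> (\<Sum>i\<in>UNIV. norm (A $ i))"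
    by (simp add: norm_vec_def L2_set_le_sum)
  also have "\<dots> \<le> (\<Sum>i\<in>UNIV. \<Sum>j\<in>UNIV. \<bar>A $ i $ j\<bar>)"
    by (intro sum_mono norm_le_l1_cart)
  also have "\<dots> \<le> (\<Sum>i\<in>(UNIV :: 'm set). \<Sum>j\<in>(UNIV :: 'n set). opnorm A)"
    by (intro sum_mono matrix_component_le_onorm)
  finally show ?thesis by simp
qed

lemma norm_matrix_mono:
  fixes A B :: "real ^ 'n ^ 'm"
  assumes "\<And>i j. \<bar>A $ i $ j\<bar> \<le> \<bar>B $ i $ j\<bar>"
  shows "norm A \<le> norm B"
  by (intro norm_le_componentwise_cart) (simp add: assms)

lemma norm_transpose:
  fixes A :: "real ^ 'n ^ 'm"
  shows "norm (transpose A) = norm A"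
  unfolding norm_vec_def L2_set_def transpose_def
  by (simp add: sum_nonneg) (rule sum.swap)

text \<open>Supplies the distributive laws, including those for differences and signs, as rewrite
  rules for the algebra below.\<close>

lemma bounded_bilinear_matrix_mult:
  "bounded_bilinear ((**) :: real ^ 'n ^ 'm \<Rightarrow> real ^ 'k ^ 'n \<Rightarrow> real ^ 'k ^ 'm)"
proof
  show "\<exists>K. \<forall>(A :: real ^ 'n ^ 'm) (B :: real ^ 'k ^ 'n). norm (A ** B) \<le> norm A * norm B * K"
    using norm_matrix_mult_le by (metis mult.right_neutral)
qed (auto simp: matrix_add_ldistrib vec_eq_iff matrix_matrix_mult_def algebra_simps
      sum.distrib sum_distrib_left)

lemmas matrix_mult_distribs =
  bounded_bilinear.add_left[OF bounded_bilinear_matrix_mult]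
  bounded_bilinear.add_right[OF bounded_bilinear_matrix_mult]
  bounded_bilinear.diff_left[OF bounded_bilinear_matrix_mult]
  bounded_bilinear.diff_right[OF bounded_bilinear_matrix_mult]
  bounded_bilinear.minus_left[OF bounded_bilinear_matrix_mult]
  bounded_bilinear.minus_right[OF bounded_bilinear_matrix_mult]

lemma transpose_add: "transpose (A + B) = transpose A + transpose B"
  and transpose_diff: "transpose (C - D) = transpose C - transpose D"
  for A B :: "'a::semigroup_add ^ 'n ^ 'm" and C D :: "'b::group_add ^ 'n ^ 'm"
  by (simp_all add: vec_eq_iff transpose_def)

section \<open>Inverses and positive definite square roots\<close>

lemma matrix_inv_left: "matrix_inv A ** A = mat 1"
  and matrix_inv_right: "A ** matrix_inv A = mat 1"
  if "invertible A" for A :: "'a::semiring_1 ^ 'n ^ 'm"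
  using someI_ex[OF that[unfolded invertible_def]] by (simp_all add: matrix_inv_def)

lemma matrix_inv_eqI:
  fixes A B :: "real ^ 'n ^ 'n"
  assumes "A ** B = mat 1"
  shows "matrix_inv A = B"
proof -
  have "invertible A"
    using assms invertible_right_inverse by blast
  then have "matrix_inv A ** (A ** B) = B"
    by (simp add: matrix_mul_assoc matrix_inv_left)
  then show ?thesis using assms by simp
qed

lemma positive_definite_invertible:
  assumes "positive_definite S"
  shows "invertible S"
proof -
  have "inj ((*v) S)"
    using assms unfolding positive_definite_def
    by (metis (no_types) inner_zero_right less_irrefl linear_injective_0 matrix_vector_mul_linear)
  then show ?thesis
    by (simp add: matrix_left_invertible_injective[symmetric] invertible_left_inverse)
qed

section \<open>Uniqueness for Sylvester equations and for positive definite square roots\<close>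

lemma trace_congruence:
  fixes S :: "real ^ 'm ^ 'm" and W :: "real ^ 'n ^ 'm"
  shows "trace (transpose W ** S ** W) = (\<Sum>j\<in>UNIV. column j W \<bullet> (S *v column j W))"
proof -
  have "(transpose W ** S ** W) $ j $ j = column j W \<bullet> (S *v column j W)" for j
    unfolding matrix_mul_assoc[symmetric]
    by (simp add: matrix_matrix_mult_def matrix_vector_mult_def transpose_def column_def inner_vec_def)
  then show ?thesis by (simp add: trace_def)
qed

text \<open>Pairing the equation with \<open>W\<close> under the trace gives tr(W^T S W) = - tr(W T
  W^T). The left side sums the form of \<open>S\<close> over the columns of \<open>W\<close>, the
  right side is minus the sum of the form of \<open>T\<close> over its rows. Both sums are
  nonnegative, hence zero, and definiteness of \<open>S\<close> kills every column.\<close>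

lemma sylvester_homogeneous_unique:
  fixes S T W :: "real ^ 'n ^ 'n"
  assumes S: "positive_definite S" and T: "positive_definite T" and eq: "S ** W + W ** T = 0"
  shows "W = 0"
proof -
  have nonneg: "0 \<le> x \<bullet> (P *v x)" if "positive_definite P" for P :: "real ^ 'n ^ 'n" and x
    using that by (cases "x = 0") (auto simp: positive_definite_def less_imp_le)
  have SW: "S ** W = - (W ** T)"
    using eq by (simp add: eq_neg_iff_add_eq_0)
  have "trace (transpose W ** S ** W) = - trace (transpose W ** (W ** T))"
    by (simp add: SW matrix_mul_assoc[symmetric] matrix_mult_distribs trace_def sum_negf)
  also have "trace (transpose W ** (W ** T)) = trace (W ** T ** transpose W)"
    by (rule trace_mul_sym)
  also have "\<dots> = (\<Sum>j\<in>UNIV. column j (transpose W) \<bullet> (T *v column j (transpose W)))"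
    using trace_congruence[of "transpose W" T] by simp
  finally have "(\<Sum>j\<in>UNIV. column j W \<bullet> (S *v column j W)) \<le> 0"
    using nonneg[OF T] by (simp add: trace_congruence sum_nonneg)
  then have "(\<Sum>j\<in>UNIV. column j W \<bullet> (S *v column j W)) = 0"
    using nonneg[OF S] by (meson antisym sum_nonneg)
  then have "\<forall>j. column j W \<bullet> (S *v column j W) = 0"
    using nonneg[OF S] by (simp add: sum_nonneg_eq_0_iff)
  then have "\<forall>j. column j W = 0"
    using S unfolding positive_definite_def by (metis less_irrefl)
  then show ?thesis
    by (simp add: vec_eq_iff column_def)
qed

text \<open>For two roots, T (T - S) + (T - S) S = T^2 - S^2 = 0 is a homogeneous Sylvester equation
  for the difference, so no spectral theory enters.\<close>

lemma pd_sqrt_eqI: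
  assumes S: "positive_definite S" and sq: "S ** S = A"
  shows "pd_sqrt A = S"
  unfolding pd_sqrt_def
proof (rule the_equality)
  fix T assume T: "positive_definite T \<and> T ** T = A"
  have "T ** (T - S) + (T - S) ** S = 0"
    using T sq by (simp add: matrix_mult_distribs)
  then have "T - S = 0"
    using sylvester_homogeneous_unique T S by blast
  then show "T = S" by simp
qed (use assms in simp)

section \<open>Diagonal matrices and the Sylvester operator\<close>

lemma diag_mat_mult:
  "diag_mat d ** A = (\<chi> i j. d $ i * A $ i $ j)"
  "B ** diag_mat d = (\<chi> i j. B $ i $ j * d $ j)"
  unfolding matrix_matrix_mult_def diag_mat_def
  by (simp_all add: vec_eq_iff if_distrib[of "\<lambda>x. x * _"] if_distrib[of "(*) _"] cong: if_cong)

lemma transpose_diag_mat [simp]: "transpose (diag_mat d) = diag_mat d"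
  by (auto simp: vec_eq_iff transpose_def diag_mat_def)

lemma diag_mat_inverse:
  assumes "\<And>i. d $ i \<noteq> 0"
  shows "diag_mat d ** diag_mat (\<chi> i. inverse (d $ i)) = mat 1"
    and "diag_mat (\<chi> i. inverse (d $ i)) ** diag_mat d = mat 1"
  using assms by (auto simp: diag_mat_mult vec_eq_iff) (auto simp: diag_mat_def mat_def)

lemma matrix_inv_diag_mat:
  assumes "\<And>i. d $ i \<noteq> 0"
  shows "matrix_inv (diag_mat d) = diag_mat (\<chi> i. inverse (d $ i))"
  by (intro matrix_inv_eqI diag_mat_inverse assms)

lemma diag_mat_quadratic_form:
  "x \<bullet> (diag_mat d *v x) = (\<Sum>i\<in>UNIV. d $ i * (x $ i)\<^sup>2)"
proof -
  have "diag_mat d *v x = (\<chi> i. d $ i * x $ i)"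
    by (simp add: vec_eq_iff matrix_vector_mult_def diag_mat_def if_distrib[of "\<lambda>x. x * _"]
        cong: if_cong)
  then show ?thesis
    by (simp add: inner_vec_def power2_eq_square ac_simps)
qed

lemma component_le_norm_diag_mat: "\<bar>d $ i\<bar> \<le> norm (diag_mat d)"
proof -
  have "\<bar>diag_mat d $ i $ i\<bar> \<le> norm (diag_mat d)"
    using component_le_norm_cart[of "diag_mat d $ i" i] Finite_Cartesian_Product.norm_nth_le[of "diag_mat d" i] by linarith
  then show ?thesis by (simp add: diag_mat_def)
qed

lemma positive_definite_diag_mat:
  assumes "\<And>i. 0 < d $ i"
  shows "positive_definite (diag_mat d)"
  unfolding positive_definite_def
proof (intro conjI allI impI)
  fix x :: "real ^ 'a" assume "x \<noteq> 0"
  then obtain k where "x $ k \<noteq> 0" by (auto simp: vec_eq_iff)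
  then show "0 < x \<bullet> (diag_mat d *v x)"
    unfolding diag_mat_quadratic_form using assms
    by (intro sum_pos2[of _ k] mult_nonneg_nonneg) (auto intro: less_imp_le)
qed simp

text \<open>Makes the norm of the inverse diagonal matrix, called \<open>b\<close> below, a common
  bound for all 1/d_i. All later estimates are stated in terms of it.\<close>

lemma inverse_le_norm_matrix_inv_diag_mat:
  assumes "\<And>i. 0 < d $ i"
  shows "inverse (d $ i) \<le> norm (matrix_inv (diag_mat d))"
proof -
  have "matrix_inv (diag_mat d) = diag_mat (\<chi> i. inverse (d $ i))"
    using assms by (intro matrix_inv_diag_mat) (simp add: less_imp_neq[symmetric])
  then show ?thesis
    using abs_le_D1[OF component_le_norm_diag_mat[of "\<chi> i. inverse (d $ i)" i]] by simp
qed

text \<open>The map X \<mapsto> D X + X D multiplies entry (i, j) by d_i + d_j, so its inverse, the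
  \<Lambda> of the overview, divides entrywise.\<close>

definition sylvester_inv :: "real ^ 'n \<Rightarrow> real ^ 'n ^ 'n \<Rightarrow> real ^ 'n ^ 'n"
  where "sylvester_inv d F = (\<chi> i j. F $ i $ j / (d $ i + d $ j))"

lemma sylvester_inv_iff:
  assumes "\<And>i. 0 < d $ i"
  shows "diag_mat d ** X + X ** diag_mat d = F \<longleftrightarrow> X = sylvester_inv d F"
proof -
  have "d $ i + d $ j \<noteq> 0" for i j
    using assms[of i] assms[of j] by linarith
  then show ?thesis
    by (simp add: diag_mat_mult sylvester_inv_def vec_eq_iff field_simps)
qed

lemma sylvester_inv_diff: "sylvester_inv d (F - G) = sylvester_inv d F - sylvester_inv d G"
  by (simp add: sylvester_inv_def vec_eq_iff diff_divide_distrib)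

lemma transpose_sylvester_inv:
  "transpose (sylvester_inv d F) = sylvester_inv d (transpose F)"
  by (simp add: sylvester_inv_def transpose_def vec_eq_iff add.commute)

text \<open>Since 1/(d_i + d_j) \<le> 1/d_i \<le> b, the result is dominated entry by entry by b F,
  and the Frobenius norm is monotone in absolute entries.\<close>

lemma norm_sylvester_inv_le:
  assumes "\<And>i. 0 < d $ i"
  shows "norm (sylvester_inv d F) \<le> norm (matrix_inv (diag_mat d)) * norm F"
proof -
  define b where "b = norm (matrix_inv (diag_mat d))"
  have "norm (sylvester_inv d F) \<le> norm (b *\<^sub>R F)"
  proof (rule norm_matrix_mono)
    fix i j
    have "inverse (d $ i + d $ j) \<le> inverse (d $ i)"
      using assms[of i] assms[of j] by (intro le_imp_inverse_le) auto
    also have "\<dots> \<le> b"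
      unfolding b_def by (rule inverse_le_norm_matrix_inv_diag_mat[OF assms])
    finally have "\<bar>inverse (d $ i + d $ j)\<bar> \<le> b"
      using assms[of i] assms[of j] by simp
    then have "\<bar>F $ i $ j\<bar> * \<bar>inverse (d $ i + d $ j)\<bar> \<le> \<bar>F $ i $ j\<bar> * b"
      by (rule mult_left_mono) simp
    then show "\<bar>sylvester_inv d F $ i $ j\<bar> \<le> \<bar>(b *\<^sub>R F) $ i $ j\<bar>"
      by (simp add: sylvester_inv_def divide_inverse abs_mult b_def mult.commute)
  qed
  then show ?thesis by (simp add: b_def)
qed

section \<open>The square root of a perturbed squared diagonal matrix\<close>

lemma sylvester_riccati_solution:
  fixes d :: "real ^ 'n" and E :: "real ^ 'n ^ 'n"
  assumes d: "\<And>i. 0 < d $ i" and b: "b = norm (matrix_inv (diag_mat d))"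
    and sym: "transpose E = E" and small: "8 * b\<^sup>2 * norm E \<le> 1"
  obtains X where "transpose X = X" "X = sylvester_inv d (E - X ** X)"
    "4 * b * norm X \<le> 1" "norm X \<le> 2 * b * norm E"
proof -
  have b0: "0 < b"
    using inverse_le_norm_matrix_inv_diag_mat[OF d] d
    by (metis b less_le_trans positive_imp_inverse_positive)
  \<comment> \<open>With b r = 1/4, the quadratic term of the map costs at most a quarter of the
    norm of X on the ball, and the Lipschitz constant 2 b r is 1/2.\<close>
  define r where "r = 1 / (4 * b)"
  have r0: "0 < r" and br: "b * r = 1 / 4"
    using b0 by (simp_all add: r_def)
  define T where "T = (\<lambda>X. sylvester_inv d (E - X ** X))"
  have inv_le: "norm (sylvester_inv d F) \<le> b * norm F" for F
    using norm_sylvester_inv_le[OF d] b by blast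
  have bound: "norm (T X) \<le> b * norm E + (1 / 4) * norm X" if "norm X \<le> r" for X
  proof -
    have "norm (T X) \<le> b * norm (E - X ** X)"
      unfolding T_def by (rule inv_le)
    also have "\<dots> \<le> b * (norm E + norm X * norm X)"
      using b0 norm_triangle_ineq4[of E "X ** X"] norm_matrix_mult_le[of X X]
      by (intro mult_left_mono) linarith+
    also have "\<dots> \<le> b * (norm E + r * norm X)"
      using that b0 by (intro mult_left_mono add_left_mono mult_right_mono) auto
    also have "\<dots> = b * norm E + (b * r) * norm X"
      by (simp add: algebra_simps)
    finally show ?thesis by (simp add: br)
  qed
  \<comment> \<open>This is the smallness hypothesis rewritten. It makes the ball invariant, because
    r/2 + r/4 \<le> r.\<close>
  have bE: "b * norm E \<le> r / 2"
    using small b0 by (simp add: r_def field_simps power2_eq_square)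
  have "\<exists>!X\<in>cball 0 r. T X = X"
  proof (rule Banach_fix[where c = "1 / 2"])
    show "complete (cball 0 r :: (real ^ 'n ^ 'n) set)"
      by (simp add: complete_eq_closed)
    show "cball 0 r \<noteq> {}" using r0 by simp
    show "T ` cball 0 r \<subseteq> cball 0 r"
    proof (clarsimp)
      fix X :: "real ^ 'n ^ 'n" assume "norm X \<le> r"
      then show "norm (T X) \<le> r" using bound[of X] bE r0 by linarith
    qed
    fix X Y :: "real ^ 'n ^ 'n" assume "X \<in> cball 0 r" "Y \<in> cball 0 r"
    then have XY: "norm X \<le> r" "norm Y \<le> r" by simp_all
    \<comment> \<open>The \<open>E\<close> terms cancel, and Y^2 - X^2 = Y (Y - X) + (Y - X) X holds
      without commutativity.\<close>
    have "T X - T Y = sylvester_inv d (Y ** (Y - X) + (Y - X) ** X)"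
      by (simp add: T_def sylvester_inv_diff[symmetric] matrix_mult_distribs)
    then have "norm (T X - T Y) \<le> b * norm (Y ** (Y - X) + (Y - X) ** X)"
      using inv_le by simp
    also have "\<dots> \<le> b * (norm Y * norm (Y - X) + norm (Y - X) * norm X)"
      using b0 by (intro mult_left_mono norm_triangle_le add_mono norm_matrix_mult_le) auto
    also have "\<dots> \<le> b * (r * norm (Y - X) + norm (Y - X) * r)"
      using b0 XY by (intro mult_left_mono add_mono mult_right_mono) auto
    also have "\<dots> = 2 * (b * r) * norm (Y - X)"
      by (simp add: algebra_simps)
    finally show "dist (T X) (T Y) \<le> 1 / 2 * dist X Y"
      by (simp add: br dist_norm norm_minus_commute)
  qed auto
  then obtain X where X: "norm X \<le> r" "T X = X"
    and unique: "\<And>Y. norm Y \<le> r \<Longrightarrow> T Y = Y \<Longrightarrow> Y = X"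
    by (metis mem_cball_0)
  \<comment> \<open>As \<open>E\<close> is symmetric, the map commutes with transposition. The
    transpose of the fixed point is then a fixed point in the same ball, so uniqueness makes
    \<open>X\<close> symmetric.\<close>
  have "T (transpose X) = transpose (T X)"
    by (simp add: T_def transpose_sylvester_inv transpose_diff matrix_transpose_mul sym)
  then have "transpose X = X"
    using X by (intro unique) (simp_all add: norm_transpose)
  \<comment> \<open>At the fixed point \<open>bound\<close> absorbs into its left side, giving the
    factor 4/3, rounded up to 2.\<close>
  moreover have "norm X \<le> 2 * b * norm E"
    using bound[OF X(1)] norm_ge_zero[of X] unfolding X(2) by linarith
  moreover have "4 * b * norm X \<le> 1"
    using X(1) b0 by (simp add: r_def field_simps)
  ultimately show ?thesis
    using that[of X] X(2) by (simp add: T_def)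
qed

text \<open>Every d_i is at least 1/b, so the diagonal form is at least |x|^2 / b, while
  \<open>X\<close> can lower it by at most its norm times |x|^2, which is strictly less.\<close>

lemma positive_definite_diag_mat_add:
  fixes d :: "real ^ 'n" and X :: "real ^ 'n ^ 'n"
  assumes d: "\<And>i. 0 < d $ i" and b: "b = norm (matrix_inv (diag_mat d))"
    and sym: "transpose X = X" and small: "b * norm X < 1"
  shows "positive_definite (diag_mat d + X)"
  unfolding positive_definite_def
proof (intro conjI allI impI)
  fix x :: "real ^ 'n" assume x: "x \<noteq> 0"
  have inv_le: "inverse (d $ i) \<le> b" for i
    unfolding b by (rule inverse_le_norm_matrix_inv_diag_mat[OF d])
  then have b0: "0 < b"
    using d by (meson less_le_trans positive_imp_inverse_positive)
  have "inverse b \<le> d $ i" for i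
    using le_imp_inverse_le[OF inv_le[of i]] d[of i] by simp
  then have "(\<Sum>i\<in>UNIV. inverse b * (x $ i)\<^sup>2) \<le> x \<bullet> (diag_mat d *v x)"
    unfolding diag_mat_quadratic_form by (intro sum_mono mult_right_mono) auto
  moreover have "(\<Sum>i\<in>UNIV. inverse b * (x $ i)\<^sup>2) = inverse b * (norm x)\<^sup>2"
    by (simp add: sum_distrib_left[symmetric] norm_vec_def L2_set_def sum_nonneg)
  moreover have "\<bar>x \<bullet> (X *v x)\<bar> \<le> norm X * (norm x)\<^sup>2"
  proof -
    have "\<bar>x \<bullet> (X *v x)\<bar> \<le> norm x * norm (X *v x)"
      by (rule Cauchy_Schwarz_ineq2)
    also have "\<dots> \<le> norm x * (norm X * norm x)"
      by (intro mult_left_mono norm_matrix_vector_mult_le) simp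
    finally show ?thesis by (simp add: power2_eq_square ac_simps)
  qed
  moreover have "norm X * (norm x)\<^sup>2 < inverse b * (norm x)\<^sup>2"
    using small b0 x by (intro mult_strict_right_mono) (simp_all add: field_simps)
  ultimately show "0 < x \<bullet> ((diag_mat d + X) *v x)"
    by (simp add: matrix_vector_mult_add_rdistrib inner_add_right)
qed (simp add: transpose_add sym)

text \<open>The resolvent identity S' = D' - D' X S' bounds the norm of S' by b plus half of
  itself.\<close>

lemma norm_matrix_inv_diag_mat_add_le:
  fixes d :: "real ^ 'n" and X :: "real ^ 'n ^ 'n"
  assumes d: "\<And>i. 0 < d $ i" and b: "b = norm (matrix_inv (diag_mat d))"
    and inv: "invertible (diag_mat d + X)" and small: "2 * b * norm X \<le> 1"
  shows "norm (matrix_inv (diag_mat d + X)) \<le> 2 * b"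
proof -
  define D' where "D' = matrix_inv (diag_mat d)"
  define S' where "S' = matrix_inv (diag_mat d + X)"
  have D': "D' ** diag_mat d = mat 1"
    using d by (simp add: D'_def matrix_inv_diag_mat diag_mat_inverse less_imp_neq[symmetric])
  have "D' ** (diag_mat d + X) ** S' = D'"
    using inv by (simp add: S'_def matrix_mul_assoc[symmetric] matrix_inv_right)
  then have "S' = D' - D' ** X ** S'"
    by (simp add: matrix_mult_distribs D' algebra_simps)
  then have "norm S' \<le> norm D' + norm (D' ** X ** S')"
    by (metis norm_triangle_ineq4)
  also have "norm (D' ** X ** S') \<le> norm D' * norm X * norm S'"
    by (meson norm_matrix_mult_le order_trans mult_right_mono norm_ge_zero)
  also have "\<dots> \<le> 1 / 2 * norm S'"
    using small by (intro mult_right_mono) (simp_all add: b D'_def)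
  finally show ?thesis by (simp add: b D'_def S'_def)
qed

section \<open>Whitening\<close>

lemma full_column_rank_column_nonzero:
  fixes M :: "real ^ 'q ^ 'p"
  assumes "rank M = CARD('q)"
  shows "column j M \<noteq> 0"
proof -
  have "inj ((*v) M)"
    using assms full_rank_injective by blast
  then have "M *v axis j 1 \<noteq> 0"
    by (metis axis_eq_0_iff injD matrix_vector_mult_0_right zero_neq_one)
  then show ?thesis by (simp add: matrix_vector_mult_basis)
qed

lemma D_c_C_c_D_c:
  fixes M :: "real ^ 'q ^ 'p"
  assumes D: "D_c M = diag_mat d" and d: "\<And>j. 0 < d $ j"
  shows "N_c M ** D_c M = M"
    and "D_c M ** C_c M ** D_c M = transpose M ** M - D_c M ** D_c M"
proof -
  show N: "N_c M ** D_c M = M"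
    using d by (simp add: N_c_def D matrix_mul_assoc[symmetric] matrix_inv_diag_mat
        diag_mat_inverse less_imp_neq[symmetric])
  have "transpose M = D_c M ** transpose (N_c M)"
    by (subst N[symmetric]) (simp add: matrix_transpose_mul D)
  then show "D_c M ** C_c M ** D_c M = transpose M ** M - D_c M ** D_c M"
    by (simp add: C_c_def matrix_mult_distribs matrix_mul_assoc[symmetric] N)
qed

lemma transpose_C_c: "transpose (C_c M) = C_c M"
  by (simp add: C_c_def transpose_diff matrix_transpose_mul)

lemma sylvester_eq_iff:
  assumes "\<And>i. 0 < d $ i"
  shows "sylvester_eq (diag_mat d) C L \<longleftrightarrow> L = sylvester_inv d (diag_mat d ** C ** diag_mat d)"
  unfolding sylvester_eq_def by (rule sylvester_inv_iff[OF assms])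

lemma L_c_eq:
  assumes "D_c M = diag_mat d" and "\<And>j. 0 < d $ j"
  shows "L_c M = sylvester_inv d (D_c M ** C_c M ** D_c M)"
  unfolding L_c_def by (rule the_equality) (use assms in \<open>simp_all add: sylvester_eq_iff\<close>)

lemma transpose_L_c:
  assumes "D_c M = diag_mat d" and "\<And>j. 0 < d $ j"
  shows "transpose (L_c M) = L_c M"
  by (simp add: L_c_eq[OF assms] transpose_sylvester_inv matrix_transpose_mul transpose_C_c assms(1)
      matrix_mul_assoc)

text \<open>Shows that the size of \<open>M\<close> is determined by its column norms, which is what
  makes the constants uniform over all \<open>M\<close> with the same \<open>D_c M\<close>.\<close>

lemma norm_eq_norm_columns:
  fixes M :: "real ^ 'q ^ 'p"
  shows "norm M = norm (\<chi> j. norm (column j M))"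
proof -
  have "norm (transpose M) = norm (\<chi> j. norm (column j M))"
    by (simp add: norm_vec_def[where 'b = 'q] transpose_def column_def)
  then show ?thesis by (simp add: norm_transpose)
qed

lemma diag_mat_eq_iff: "diag_mat c = diag_mat d \<longleftrightarrow> c = d"
  by (auto simp: diag_mat_def vec_eq_iff)

text \<open>The remainders are written exactly as products of \<open>N\<close>, a factor small in
  \<open>E\<close>, and the inverse root, and each factor is bounded separately. The symmetry of the
  inverse root is recorded for the row version.\<close>

lemma column_whitening_expansion:
  fixes M :: "real ^ 'q ^ 'p" and d :: "real ^ 'q"
  assumes D: "D_c M = diag_mat d" and d: "\<And>j. 0 < d $ j"
    and b: "b = norm (matrix_inv (diag_mat d))" and E: "E = D_c M ** C_c M ** D_c M"
    and small: "8 * b\<^sup>2 * norm E \<le> 1"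
  shows "transpose (inv_sqrt (transpose M ** M)) = inv_sqrt (transpose M ** M)"
    and "norm (Orth_r M - (N_c M - N_c M ** L_c M ** matrix_inv (D_c M)))
      \<le> 12 * norm d * b ^ 5 * (norm E)\<^sup>2"
    and "norm (Orth_r M - N_c M) \<le> 4 * norm d * b ^ 3 * norm E"
proof -
  have b0: "0 \<le> b" by (simp add: b)
  have symE: "transpose E = E"
    by (simp add: E D matrix_transpose_mul transpose_C_c matrix_mul_assoc)
  obtain X where X: "transpose X = X" "X = sylvester_inv d (E - X ** X)"
    and X1: "4 * b * norm X \<le> 1" and XE: "norm X \<le> 2 * b * norm E"
    using sylvester_riccati_solution[OF d b symE small] .
  define S where "S = diag_mat d + X"
  define S' where "S' = matrix_inv S"
  define D' where "D' = matrix_inv (diag_mat d)"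
  define N where "N = N_c M"
  define L where "L = L_c M"
  have pd: "positive_definite S"
    unfolding S_def using X1 b0 by (intro positive_definite_diag_mat_add[OF d b X(1)]) linarith
  then have inv: "invertible S" by (rule positive_definite_invertible)
  have "diag_mat d ** X + X ** diag_mat d = E - X ** X"
    using X(2) sylvester_inv_iff[OF d] by blast
  then have "S ** S = diag_mat d ** diag_mat d + E"
    by (simp add: S_def matrix_mult_distribs algebra_simps)
  also have "\<dots> = transpose M ** M"
    using D_c_C_c_D_c(2)[OF D d] by (simp add: E D)
  finally have sqrt: "inv_sqrt (transpose M ** M) = S'"
    by (simp add: inv_sqrt_def S'_def pd_sqrt_eqI[OF pd])
  have "transpose S = S"
    using pd by (simp add: positive_definite_def)
  then have "S ** transpose S' = mat 1"
    using inv by (metis S'_def matrix_inv_left matrix_transpose_mul transpose_mat)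
  then show "transpose (inv_sqrt (transpose M ** M)) = inv_sqrt (transpose M ** M)"
    unfolding sqrt using matrix_inv_eqI[of S "transpose S'"] by (simp add: S'_def)
  have D'D: "D' ** diag_mat d = mat 1"
    using d by (simp add: D'_def matrix_inv_diag_mat diag_mat_inverse less_imp_neq[symmetric])
  have SS': "S ** S' = mat 1"
    using inv by (simp add: S'_def matrix_inv_right)
  have Orth: "Orth_r M = N ** diag_mat d ** S'"
    using D_c_C_c_D_c(1)[OF D d] by (simp add: Orth_r_def sqrt N_def D)
  \<comment> \<open>Since D = S - X, one has D S' = 1 - X S'. This already exhibits an error linear
    in \<open>X\<close>.\<close>
  have first: "Orth_r M - N = - (N ** (X ** S'))"
  proof -
    have "diag_mat d ** S' - mat 1 = - (X ** S')"
      using SS' by (simp add: S_def matrix_mult_distribs algebra_simps)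
    then have "N ** (diag_mat d ** S' - mat 1) = - (N ** (X ** S'))"
      by (simp add: matrix_mult_distribs)
    then show ?thesis
      by (simp add: Orth matrix_mult_distribs matrix_mul_assoc)
  qed
  \<comment> \<open>\<open>L\<close> is \<Lambda> E, the linear part of the fixed point equation, so
    only the quadratic part remains.\<close>
  have XL: "X - L = - sylvester_inv d (X ** X)"
    using X(2) L_c_eq[OF D d] by (simp add: L_def E[symmetric] sylvester_inv_diff algebra_simps)
  \<comment> \<open>Substituting D' = S' + D' X S' lets S' factor out on the right. Both terms left
    in the bracket are of second order in \<open>E\<close>.\<close>
  have second: "Orth_r M - (N - N ** L ** D') = N ** ((L ** D' ** X - (X - L)) ** S')"
  proof -
    have "D' = D' ** (S ** S')" by (simp add: SS')
    also have "\<dots> = S' + D' ** X ** S'"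
      by (simp add: S_def matrix_mul_assoc matrix_mult_distribs D'D)
    finally have "L ** D' = L ** S' + L ** (D' ** X ** S')"
      by (metis bounded_bilinear.add_right[OF bounded_bilinear_matrix_mult])
    then have "L ** D' - X ** S' = (L ** D' ** X - (X - L)) ** S'"
      by (simp add: matrix_mult_distribs matrix_mul_assoc add.commute)
    moreover have "Orth_r M - (N - N ** L ** D') = N ** (L ** D' - X ** S')"
      using first by (simp add: matrix_mult_distribs matrix_mul_assoc algebra_simps)
    ultimately show ?thesis by simp
  qed
  have "d = (\<chi> j. norm (column j M))"
    using D by (simp add: D_c_def diag_mat_eq_iff)
  then have normN: "norm N \<le> norm d * b"
    using norm_matrix_mult_le[of M "matrix_inv (D_c M)"] norm_eq_norm_columns[of M]
    by (simp add: N_def N_c_def D b)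
  have "2 * b * norm X \<le> 1"
    using X1 mult_nonneg_nonneg[OF b0 norm_ge_zero[of X]] by linarith
  then have normS': "norm S' \<le> 2 * b"
    using inv norm_matrix_inv_diag_mat_add_le[OF d b, of X] by (simp add: S'_def S_def)
  have normL: "norm L \<le> b * norm E"
    using norm_sylvester_inv_le[OF d, of E] by (simp add: L_def L_c_eq[OF D d] E b)
  have "norm (X - L) \<le> b * norm (X ** X)"
    unfolding XL using norm_sylvester_inv_le[OF d, of "X ** X"] by (simp add: b)
  also have "\<dots> \<le> b * ((2 * b * norm E) * (2 * b * norm E))"
    by (intro mult_left_mono b0 order_trans[OF norm_matrix_mult_le] mult_mono XE) (simp_all add: b0)
  finally have normXL: "norm (X - L) \<le> 4 * b ^ 3 * (norm E)\<^sup>2"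
    by (simp add: power2_eq_square power3_eq_cube ac_simps)
  have "norm (L ** D' ** X) \<le> (b * norm E * b) * (2 * b * norm E)"
    by (intro order_trans[OF norm_matrix_mult_le] mult_mono XE normL) (simp_all add: b0 b D'_def)
  then have "norm (L ** D' ** X) \<le> 2 * b ^ 3 * (norm E)\<^sup>2"
    by (simp add: power2_eq_square power3_eq_cube ac_simps)
  then have mid: "norm (L ** D' ** X - (X - L)) \<le> 6 * b ^ 3 * (norm E)\<^sup>2"
    using normXL norm_triangle_ineq4[of "L ** D' ** X" "X - L"] by linarith
  \<comment> \<open>The factors are \<open>normN\<close>, \<open>mid\<close> and
    \<open>normS'\<close>; the constant 12 is 6 times 2.\<close>
  have "norm (Orth_r M - (N - N ** L ** D'))
      \<le> (norm d * b) * ((6 * b ^ 3 * (norm E)\<^sup>2) * (2 * b))"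
    unfolding second
    by (intro order_trans[OF norm_matrix_mult_le] mult_mono normN mid normS') (simp_all add: b0)
  then show "norm (Orth_r M - (N_c M - N_c M ** L_c M ** matrix_inv (D_c M)))
      \<le> 12 * norm d * b ^ 5 * (norm E)\<^sup>2"
    by (simp add: N_def L_def D'_def D eval_nat_numeral ac_simps)
  have "norm (Orth_r M - N) \<le> (norm d * b) * ((2 * b * norm E) * (2 * b))"
    unfolding first norm_minus_cancel
    by (intro order_trans[OF norm_matrix_mult_le] mult_mono normN XE normS') (simp_all add: b0)
  then show "norm (Orth_r M - N_c M) \<le> 4 * norm d * b ^ 3 * norm E"
    by (simp add: N_def eval_nat_numeral ac_simps)
qed

text \<open>Fixes \<delta> and K from d and the dimension alone and passes to operator norms on the
  right. The left sides keep the Frobenius norm, so that the bounds survive transposition.\<close>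

lemma column_whitening_bound:
  fixes d :: "real ^ 'q"
  assumes d: "\<And>j. 0 < d $ j"
  obtains \<delta> K where "0 < \<delta>" "0 < K"
    "\<And>M :: real ^ 'q ^ 'p. D_c M = diag_mat d \<Longrightarrow> opnorm (D_c M ** C_c M ** D_c M) \<le> \<delta> \<Longrightarrow>
       transpose (inv_sqrt (transpose M ** M)) = inv_sqrt (transpose M ** M) \<and>
       norm (Orth_r M - (N_c M - N_c M ** L_c M ** matrix_inv (D_c M)))
         \<le> K * (opnorm (D_c M ** C_c M ** D_c M))\<^sup>2 \<and>
       norm (Orth_r M - N_c M) \<le> K * opnorm (C_c M)"
proof -
  define b where "b = norm (matrix_inv (diag_mat d))"
  define c where "c = real (CARD('q) * CARD('q))"
  define K1 where "K1 = 12 * norm d * b ^ 5 * c\<^sup>2"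
  define K2 where "K2 = 4 * norm d * b ^ 3 * (norm (diag_mat d) * c * norm (diag_mat d))"
  \<comment> \<open>One constant serves both bounds; the summand 1 makes it positive.\<close>
  define K where "K = K1 + K2 + 1"
  have b0: "0 \<le> b" and c0: "0 < c" by (simp_all add: b_def c_def)
  have K12: "0 \<le> K1" "0 \<le> K2"
    using b0 c0 by (simp_all add: K1_def K2_def)
  \<comment> \<open>Ensures 8 b^2 c \<delta> \<le> 1; the 1 in the denominator keeps it
    positive.\<close>
  define \<delta> where "\<delta> = 1 / (8 * b\<^sup>2 * c + 1)"
  have den: "0 < 8 * b\<^sup>2 * c + 1"
    using c0 by (simp add: add_nonneg_pos)
  show ?thesis
  proof (rule that[of \<delta> K])
    show "0 < \<delta>" using den by (simp add: \<delta>_def)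
    show "0 < K" using K12 by (simp add: K_def)
    fix M :: "real ^ 'q ^ 'p"
    define E where "E = D_c M ** C_c M ** D_c M"
    assume D: "D_c M = diag_mat d" and "opnorm (D_c M ** C_c M ** D_c M) \<le> \<delta>"
    then have le: "opnorm E \<le> \<delta>" by (simp add: E_def)
    have normE: "norm E \<le> c * opnorm E"
      using norm_le_opnorm[of E] by (simp add: c_def)
    have "8 * b\<^sup>2 * norm E \<le> 8 * b\<^sup>2 * (c * opnorm E)"
      by (intro mult_left_mono normE) simp
    also have "\<dots> = (8 * b\<^sup>2 * c) * opnorm E" by simp
    also have "\<dots> \<le> (8 * b\<^sup>2 * c) * \<delta>"
      using c0 by (intro mult_left_mono le) simp
    also have "\<dots> \<le> 1"
      using den by (simp add: \<delta>_def divide_le_eq_1)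
    finally have small: "8 * b\<^sup>2 * norm E \<le> 1" .
    note expansion = column_whitening_expansion[OF D d b_def E_def small]
    have "norm (Orth_r M - (N_c M - N_c M ** L_c M ** matrix_inv (D_c M)))
        \<le> 12 * norm d * b ^ 5 * (c * opnorm E)\<^sup>2"
      by (rule order_trans[OF expansion(2)])
        (intro mult_left_mono power_mono normE, simp_all add: b0)
    also have "\<dots> = K1 * (opnorm E)\<^sup>2"
      by (simp add: K1_def power_mult_distrib)
    also have "\<dots> \<le> K * (opnorm E)\<^sup>2"
      using K12 by (intro mult_right_mono) (simp_all add: K_def)
    finally have second: "norm (Orth_r M - (N_c M - N_c M ** L_c M ** matrix_inv (D_c M)))
        \<le> K * (opnorm E)\<^sup>2" .
    \<comment> \<open>The weaker expansion is measured by \<open>C_c M\<close>, so the two diagonal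
      factors of \<open>E\<close> go into \<open>K2\<close>.\<close>
    have "norm E \<le> norm (diag_mat d) * (c * opnorm (C_c M)) * norm (diag_mat d)"
      unfolding E_def D using norm_le_opnorm[of "C_c M"] opnorm_nonneg[of "C_c M"] c0
      by (intro order_trans[OF norm_matrix_mult_le] mult_mono) (simp_all add: c_def)
    then have "norm (Orth_r M - N_c M)
        \<le> 4 * norm d * b ^ 3 * (norm (diag_mat d) * (c * opnorm (C_c M)) * norm (diag_mat d))"
      by (intro order_trans[OF expansion(3)] mult_left_mono) (simp_all add: b0)
    also have "\<dots> = K2 * opnorm (C_c M)"
      by (simp add: K2_def)
    also have "\<dots> \<le> K * opnorm (C_c M)"
      using K12 by (intro mult_right_mono opnorm_nonneg) (simp add: K_def)
    finally show "transpose (inv_sqrt (transpose M ** M)) = inv_sqrt (transpose M ** M) \<and>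
       norm (Orth_r M - (N_c M - N_c M ** L_c M ** matrix_inv (D_c M)))
         \<le> K * (opnorm (D_c M ** C_c M ** D_c M))\<^sup>2 \<and>
       norm (Orth_r M - N_c M) \<le> K * opnorm (C_c M)"
      using expansion(1) second by (simp add: E_def)
  qed
qed

section \<open>Row whitening as column whitening of the transpose\<close>

lemma row_column_duality:
  fixes M :: "real ^ 'q ^ 'p"
  assumes D: "D_r M = diag_mat d" and d: "\<And>i. 0 < d $ i"
  shows "D_c (transpose M) = diag_mat d"
    and "N_r M = transpose (N_c (transpose M))"
    and "C_r M = C_c (transpose M)"
    and "L_r M = L_c (transpose M)"
proof -
  show Dc: "D_c (transpose M) = diag_mat d"
    using D by (simp add: D_r_def D_c_def)
  show N: "N_r M = transpose (N_c (transpose M))"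
    using d by (simp add: N_r_def N_c_def D Dc matrix_transpose_mul matrix_inv_diag_mat
        less_imp_neq[symmetric])
  show C: "C_r M = C_c (transpose M)"
    by (simp add: C_r_def C_c_def N)
  show "L_r M = L_c (transpose M)"
    by (simp add: L_r_def L_c_def D Dc C)
qed

theorem proposition3p2:
  shows
    "((\<forall>M :: real ^ 'q ^ 'p. rank M = CARD('q) \<longrightarrow>
         positive_definite (D_c M) \<and> (\<exists>!L. sylvester_eq (D_c M) (C_c M) L)) \<and>
      (\<forall>d :: real ^ 'q. (\<forall>j. 0 < d $ j) \<longrightarrow>
         (\<exists>\<delta>>0. \<exists>K>0. \<forall>M :: real ^ 'q ^ 'p.
            rank M = CARD('q) \<and> D_c M = diag_mat d \<and>
            opnorm (D_c M ** C_c M ** D_c M) \<le> \<delta> \<longrightarrow>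
              opnorm (Orth_r M - (N_c M - N_c M ** L_c M ** matrix_inv (D_c M)))
                \<le> K * (opnorm (D_c M ** C_c M ** D_c M))\<^sup>2 \<and>
              opnorm (Orth_r M - N_c M) \<le> K * opnorm (C_c M))))
     \<and>
     ((\<forall>M :: real ^ 'q ^ 'p. rank M = CARD('p) \<longrightarrow>
         positive_definite (D_r M) \<and> (\<exists>!L. sylvester_eq (D_r M) (C_r M) L)) \<and>
      (\<forall>d :: real ^ 'p. (\<forall>i. 0 < d $ i) \<longrightarrow>
         (\<exists>\<delta>>0. \<exists>K>0. \<forall>M :: real ^ 'q ^ 'p.
            rank M = CARD('p) \<and> D_r M = diag_mat d \<and>
            opnorm (D_r M ** C_r M ** D_r M) \<le> \<delta> \<longrightarrow>
              opnorm (Orth_l M - (N_r M - matrix_inv (D_r M) ** L_r M ** N_r M))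
                \<le> K * (opnorm (D_r M ** C_r M ** D_r M))\<^sup>2 \<and>
              opnorm (Orth_l M - N_r M) \<le> K * opnorm (C_r M))))"
proof (intro conjI allI impI)
  fix M :: "real ^ 'q ^ 'p"
  assume "rank M = CARD('q)"
  then have pos: "0 < (\<chi> j. norm (column j M)) $ j" for j
    by (simp add: full_column_rank_column_nonzero)
  then show "positive_definite (D_c M)"
    unfolding D_c_def by (rule positive_definite_diag_mat)
  show "\<exists>!L. sylvester_eq (D_c M) (C_c M) L"
    \<comment> \<open>The equation is equivalent to an explicit formula for L, which gives existence
      and uniqueness together.\<close>
    unfolding D_c_def sylvester_eq_iff[OF pos] by simp
next
  fix M :: "real ^ 'q ^ 'p"
  assume "rank M = CARD('p)"
  then have "column i (transpose M) \<noteq> 0" for i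
    by (intro full_column_rank_column_nonzero) (simp add: rank_transpose)
  then have pos: "0 < (\<chi> i. norm (row i M)) $ i" for i
    by simp
  then show "positive_definite (D_r M)"
    unfolding D_r_def by (rule positive_definite_diag_mat)
  show "\<exists>!L. sylvester_eq (D_r M) (C_r M) L"
    unfolding D_r_def sylvester_eq_iff[OF pos] by simp
next
  fix d :: "real ^ 'q"
  assume "\<forall>j. 0 < d $ j"
  then have d: "\<And>j. 0 < d $ j" by blast
  obtain \<delta> K where "0 < \<delta>" "0 < K" and bound:
    "\<And>M :: real ^ 'q ^ 'p. D_c M = diag_mat d \<Longrightarrow> opnorm (D_c M ** C_c M ** D_c M) \<le> \<delta> \<Longrightarrow>
       transpose (inv_sqrt (transpose M ** M)) = inv_sqrt (transpose M ** M) \<and>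
       norm (Orth_r M - (N_c M - N_c M ** L_c M ** matrix_inv (D_c M)))
         \<le> K * (opnorm (D_c M ** C_c M ** D_c M))\<^sup>2 \<and>
       norm (Orth_r M - N_c M) \<le> K * opnorm (C_c M)"
    using column_whitening_bound[where 'p = 'p, OF d] by blast
  show "\<exists>\<delta>>0. \<exists>K>0. \<forall>M :: real ^ 'q ^ 'p.
            rank M = CARD('q) \<and> D_c M = diag_mat d \<and>
            opnorm (D_c M ** C_c M ** D_c M) \<le> \<delta> \<longrightarrow>
              opnorm (Orth_r M - (N_c M - N_c M ** L_c M ** matrix_inv (D_c M)))
                \<le> K * (opnorm (D_c M ** C_c M ** D_c M))\<^sup>2 \<and>
              opnorm (Orth_r M - N_c M) \<le> K * opnorm (C_c M)"
    using bound \<open>0 < \<delta>\<close> \<open>0 < K\<close> by (meson opnorm_le_norm order_trans)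
next
  fix d :: "real ^ 'p"
  assume "\<forall>i. 0 < d $ i"
  then have d: "\<And>i. 0 < d $ i" by blast
  obtain \<delta> K where "0 < \<delta>" "0 < K" and bound:
    "\<And>M :: real ^ 'p ^ 'q. D_c M = diag_mat d \<Longrightarrow> opnorm (D_c M ** C_c M ** D_c M) \<le> \<delta> \<Longrightarrow>
       transpose (inv_sqrt (transpose M ** M)) = inv_sqrt (transpose M ** M) \<and>
       norm (Orth_r M - (N_c M - N_c M ** L_c M ** matrix_inv (D_c M)))
         \<le> K * (opnorm (D_c M ** C_c M ** D_c M))\<^sup>2 \<and>
       norm (Orth_r M - N_c M) \<le> K * opnorm (C_c M)"
    using column_whitening_bound[where 'p = 'q, OF d] by blast
  have "opnorm (Orth_l M - (N_r M - matrix_inv (D_r M) ** L_r M ** N_r M))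
          \<le> K * (opnorm (D_r M ** C_r M ** D_r M))\<^sup>2 \<and>
        opnorm (Orth_l M - N_r M) \<le> K * opnorm (C_r M)"
    if D: "D_r M = diag_mat d" and le: "opnorm (D_r M ** C_r M ** D_r M) \<le> \<delta>"
    for M :: "real ^ 'q ^ 'p"
  proof -
    note dual = row_column_duality[OF D d]
    have le': "opnorm (D_c (transpose M) ** C_c (transpose M) ** D_c (transpose M)) \<le> \<delta>"
      using le by (simp add: D dual)
    \<comment> \<open>Transposing reverses the product; the symmetry of the inverse root in
      \<open>bound\<close> restores the same root on the left.\<close>
    have "Orth_l M = transpose (Orth_r (transpose M))"
      using bound[OF dual(1) le'] by (simp add: Orth_l_def Orth_r_def matrix_transpose_mul)
    \<comment> \<open>Here the symmetry of \<open>L_c\<close> and of the diagonal factor plays the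
      same part.\<close>
    moreover have "matrix_inv (D_r M) ** L_r M ** N_r M =
        transpose (N_c (transpose M) ** L_c (transpose M) ** matrix_inv (D_c (transpose M)))"
      using d transpose_L_c[OF dual(1) d]
      by (simp add: D dual matrix_transpose_mul matrix_inv_diag_mat less_imp_neq[symmetric]
          matrix_mul_assoc)
    ultimately have
      "Orth_l M - (N_r M - matrix_inv (D_r M) ** L_r M ** N_r M) =
        transpose (Orth_r (transpose M) - (N_c (transpose M) -
          N_c (transpose M) ** L_c (transpose M) ** matrix_inv (D_c (transpose M))))"
      "Orth_l M - N_r M = transpose (Orth_r (transpose M) - N_c (transpose M))"
      by (simp_all add: dual(2) transpose_diff)
    then have
      "norm (Orth_l M - (N_r M - matrix_inv (D_r M) ** L_r M ** N_r M))
          \<le> K * (opnorm (D_r M ** C_r M ** D_r M))\<^sup>2"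
      "norm (Orth_l M - N_r M) \<le> K * opnorm (C_r M)"
      using bound[OF dual(1) le'] by (simp_all only: norm_transpose D dual)
    then show ?thesis
      by (meson opnorm_le_norm order_trans)
  qed
  then show "\<exists>\<delta>>0. \<exists>K>0. \<forall>M :: real ^ 'q ^ 'p.
            rank M = CARD('p) \<and> D_r M = diag_mat d \<and>
            opnorm (D_r M ** C_r M ** D_r M) \<le> \<delta> \<longrightarrow>
              opnorm (Orth_l M - (N_r M - matrix_inv (D_r M) ** L_r M ** N_r M))
                \<le> K * (opnorm (D_r M ** C_r M ** D_r M))\<^sup>2 \<and>
              opnorm (Orth_l M - N_r M) \<le> K * opnorm (C_r M)"
    using \<open>0 < \<delta>\<close> \<open>0 < K\<close> by blast
qed

end
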